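(* Let $X$ and $Y$ be linear spaces over a field $\mathbb{K}$ and let $f, f_{1,1}, f_{1,2}, f_{2,1}, f_{2,2}\colon X\times Y\to \mathbb{K}$ be functions that all vanish at $(0,0)$. Then \[ f(x_{1}+x_{2},0)=f_{1,1}(x_{1},0)+f_{1,2}(x_{1},0)+f_{2,1}(x_{2},0)+f_{2,2}(x_{2},0) \qquad (x_{1}, x_{2}\in X) \] holds if and only if there exists an additive function $\chi\colon X\to \mathbb{K}$ such that for all $x\in X$ \[ f(x,0)=\chi(x),\qquad f_{1,1}(x,0)+f_{1,2}(x,0)=\chi(x),\qquad f_{2,1}(x,0)+f_{2,2}(x,0)=\chi(x). \]
   Context: A function $\chi\colon X\to\mathbb{K}$ is additive if $\chi(x+x')=\chi(x)+\chi(x')$ for all $x,x'\in X$. *)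

theory Defs
  imports Complex_Main
begin

end

theory Submission
  imports Defs
begin

text \<open>
  Restricted to \<open>X \<times> {0}\<close>, the equation is Pexider's equation
  \<open>F (x + y) = G x + H y\<close> with \<open>G\<close> and \<open>H\<close> the two pairwise sums. Setting one argument to zero
  kills one summand on the right, because all functions vanish at the origin, so
  \<open>F = G\<close> and \<open>F = H\<close>; the equation then says that \<open>F\<close> itself is additive. The individual
  summands remain undetermined, since only their sums enter the equation.
\<close>

text \<open>
  The normalisation of \<open>G\<close> and \<open>H\<close> at zero rules out the additive constants that occur in the
  general solution of Pexider's equation.
\<close>

lemma normalized_pexider_iff_additive:
  fixes F G H :: "'a::ab_group_add \<Rightarrow> 'b::ab_group_add"
  assumes G0: "G 0 = 0" and H0: "H 0 = 0"
  shows "(\<forall>x y. F (x + y) = G x + H y) \<longleftrightarrow> additive F \<and> G = F \<and> H = F"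
proof
  assume eq: "\<forall>x y. F (x + y) = G x + H y"
  have "G x = F x" for x
    using eq[rule_format, of x 0] H0 by simp
  moreover have "H y = F y" for y
    using eq[rule_format, of 0 y] G0 by simp
  ultimately show "additive F \<and> G = F \<and> H = F"
    using eq by (auto simp: additive_def)
next
  assume "additive F \<and> G = F \<and> H = F"
  then show "\<forall>x y. F (x + y) = G x + H y"
    by (simp add: additive.add)
qed

theorem proposition4:
  fixes scaleX :: "'k::field \<Rightarrow> 'x::ab_group_add \<Rightarrow> 'x"
    and scaleY :: "'k \<Rightarrow> 'y::ab_group_add \<Rightarrow> 'y"
    and f f11 f12 f21 f22 :: "'x \<times> 'y \<Rightarrow> 'k"
  assumes "vector_space scaleX"
    and "vector_space scaleY"
    and "f (0, 0) = 0"
    and "f11 (0, 0) = 0"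
    and "f12 (0, 0) = 0"
    and "f21 (0, 0) = 0"
    and "f22 (0, 0) = 0"
  shows "(\<forall>x1 x2. f (x1 + x2, 0) = f11 (x1, 0) + f12 (x1, 0) + f21 (x2, 0) + f22 (x2, 0))
    \<longleftrightarrow> (\<exists>\<chi> :: 'x \<Rightarrow> 'k. additive \<chi> \<and>
          (\<forall>x. f (x, 0) = \<chi> x
             \<and> f11 (x, 0) + f12 (x, 0) = \<chi> x
             \<and> f21 (x, 0) + f22 (x, 0) = \<chi> x))"
proof -
  let ?F = "\<lambda>x. f (x, 0)"
  let ?G = "\<lambda>x. f11 (x, 0) + f12 (x, 0)"
  let ?H = "\<lambda>x. f21 (x, 0) + f22 (x, 0)"
  have "(\<forall>x1 x2. ?F (x1 + x2) = ?G x1 + ?H x2) \<longleftrightarrow> additive ?F \<and> ?G = ?F \<and> ?H = ?F"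
    by (rule normalized_pexider_iff_additive) (simp_all add: assms)
  also have "\<dots> \<longleftrightarrow> (\<exists>\<chi>. additive \<chi> \<and> (\<forall>x. ?F x = \<chi> x \<and> ?G x = \<chi> x \<and> ?H x = \<chi> x))"
  proof
    assume "additive ?F \<and> ?G = ?F \<and> ?H = ?F"
    then show "\<exists>\<chi>. additive \<chi> \<and> (\<forall>x. ?F x = \<chi> x \<and> ?G x = \<chi> x \<and> ?H x = \<chi> x)"
      by (intro exI[of _ ?F]) (auto dest: fun_cong)
  next
    assume "\<exists>\<chi>. additive \<chi> \<and> (\<forall>x. ?F x = \<chi> x \<and> ?G x = \<chi> x \<and> ?H x = \<chi> x)"
    then show "additive ?F \<and> ?G = ?F \<and> ?H = ?F"
      by auto
  qed
  finally show ?thesis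
    by (simp add: add.assoc)
qed

end
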